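(* Let $V$ be a real or complex vector space of finite dimension $n$, let $\{v_1,\dots,v_n\}$ and $\{w_1,\dots,w_n\}$ be two bases of $V$, and let $A$ be the change of basis matrix from $\{v_1,\dots,v_n\}$ to $\{w_1,\dots,w_n\}$. Then $\{v_1,\dots,v_n\}$ and $\{w_1,\dots,w_n\}$ are woven if and only if all central sub-matrices of $A$ are invertible.
   Context: In a finite-dimensional space, a finite family is a frame if and only if it spans the space. Two frames $\{v_i\}_{i\in I}$ and $\{w_i\}_{i\in I}$ with the same index set $I$ are woven if for every $J\subset I$ the family $\{v_i\}_{i\in J}\cup\{w_i\}_{i\in I\setminus J}$ (as an indexed family) is a frame of the space. The change of basis matrix from $\{v_1,\dots,v_n\}$ to $\{w_1,\dots,w_n\}$ is the matrix $A=(a_{i,j})_{i,j=1}^n$ such that $w_i=a_{1,i}v_1+\dots+a_{n,i}v_n$ for each $i=1,\dots,n$. The central sub-matrices of $A$ are the matrices $(a_{j,k})_{j,k\in J}$ where $J$ is any nonempty subset of $\{1,\dots,n\}$. *)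

theory Defs
  imports Complex_Main "Jordan_Normal_Form.DL_Submatrix"
begin

definition basis_family ::
    "('k::field \<Rightarrow> 'v::ab_group_add \<Rightarrow> 'v) \<Rightarrow> 'i set \<Rightarrow> ('i \<Rightarrow> 'v) \<Rightarrow> bool" where
  "basis_family scale I v \<longleftrightarrow>
     inj_on v I \<and> \<not> module.dependent scale (v ` I) \<and> module.span scale (v ` I) = UNIV"

text \<open>In a finite-dimensional space a finite family is a frame exactly when it spans; since no
  inner product is given, this is taken as the meaning of frame.\<close>

definition frame ::
    "('k::field \<Rightarrow> 'v::ab_group_add \<Rightarrow> 'v) \<Rightarrow> 'i set \<Rightarrow> ('i \<Rightarrow> 'v) \<Rightarrow> bool" where
  "frame scale I v \<longleftrightarrow> finite I \<and> module.span scale (v ` I) = UNIV"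

definition woven ::
    "('k::field \<Rightarrow> 'v::ab_group_add \<Rightarrow> 'v) \<Rightarrow> 'i set \<Rightarrow> ('i \<Rightarrow> 'v) \<Rightarrow> ('i \<Rightarrow> 'v) \<Rightarrow> bool" where
  "woven scale I v w \<longleftrightarrow> frame scale I v \<and> frame scale I w \<and>
     (\<forall>J. J \<subseteq> I \<longrightarrow> frame scale I (\<lambda>i. if i \<in> J then v i else w i))"

text \<open>Indices run over \<open>0, \<dots>, n - 1\<close>, following the convention for \<^typ>\<open>'a mat\<close>; the coordinates
  of \<open>w i\<close> with respect to \<open>v\<close> form the \<open>i\<close>-th column.\<close>

definition change_of_basis_mat ::
    "('k::field \<Rightarrow> 'v::ab_group_add \<Rightarrow> 'v) \<Rightarrow> nat \<Rightarrow> (nat \<Rightarrow> 'v) \<Rightarrow> (nat \<Rightarrow> 'v) \<Rightarrow> 'k mat \<Rightarrow> bool" where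
  "change_of_basis_mat scale n v w A \<longleftrightarrow> A \<in> carrier_mat n n \<and>
     (\<forall>i<n. w i = (\<Sum>j<n. scale (A $$ (j, i)) (v j)))"

definition central_submatrices :: "'a mat \<Rightarrow> 'a mat set" where
  "central_submatrices A = {submatrix A J J | J. J \<noteq> {} \<and> J \<subseteq> {..<dim_row A}}"

text \<open>To treat real and complex vector spaces at once, scalars are taken from a type of class
  \<^class>\<open>real_normed_field\<close>. Both \<^typ>\<open>real\<close> and \<^typ>\<open>complex\<close> are instances, and by the
  Gelfand--Mazur theorem every instance is isomorphic to one of them.\<close>

end

theory Submission
  imports Defs "Jordan_Normal_Form.Determinant"
begin

text \<open>Replace the vectors \<open>v i\<close> by \<open>w i\<close> for the indices \<open>i\<close> in a set \<open>K\<close>. The resulting \<open>n\<close>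
  vectors span an \<open>n\<close>-dimensional space exactly when they satisfy no nontrivial linear relation
  (\<open>spans_iff_independent_family\<close>), so the frame property becomes a statement about relations.
  Expanding each \<open>w i\<close> in the basis \<open>v\<close>, the combination with coefficients \<open>c\<close> has \<open>j\<close>-th coordinate
  \<open>\<Sum>i\<in>K. A $$ (j, i) * c i\<close>, plus \<open>c j\<close> when \<open>j \<notin> K\<close>. The coordinates outside \<open>K\<close> can
  therefore be solved for the \<open>c j\<close> with \<open>j \<notin> K\<close>, whatever the coefficients on \<open>K\<close> are,
  while the coordinates in \<open>K\<close> say precisely that \<open>c\<close>, restricted to \<open>K\<close>, lies in the kernel of
  the central submatrix indexed by \<open>K\<close>. Hence the mixed family is a frame iff that kernel is
  trivial (\<open>exchange_independent_iff\<close>), that is, iff the submatrix is invertible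
  (\<open>invertible_submatrix_iff\<close>). Letting \<open>K\<close> run over all subsets gives the theorem; the empty
  \<open>K\<close> yields \<open>v\<close> itself, which is why only nonempty index sets appear on the matrix side.\<close>

text \<open>Independence of an indexed family differs from independence of its range: a repeated vector
  makes the family dependent. The indexed notion is the one in which a relation is a coefficient
  vector, so that it can be compared with the kernel of a matrix.\<close>

definition independent_family ::
    "('k::field \<Rightarrow> 'v::ab_group_add \<Rightarrow> 'v) \<Rightarrow> 'i set \<Rightarrow> ('i \<Rightarrow> 'v) \<Rightarrow> bool" where
  "independent_family scale I u \<longleftrightarrow>
     (\<forall>c. (\<Sum>i\<in>I. scale (c i) (u i)) = 0 \<longrightarrow> (\<forall>i\<in>I. c i = 0))"

text \<open>Triviality of the kernel of a central submatrix, stated with the original indices so that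
  no enumeration of \<open>K\<close> is involved.\<close>

definition trivial_kernel_on :: "'k::field mat \<Rightarrow> nat set \<Rightarrow> bool" where
  "trivial_kernel_on A K \<longleftrightarrow>
     (\<forall>c. (\<forall>j\<in>K. (\<Sum>i\<in>K. A $$ (j, i) * c i) = 0) \<longrightarrow> (\<forall>i\<in>K. c i = 0))"

section \<open>Independent indexed families\<close>

lemma (in vector_space) independent_family_iff:
  assumes "finite I"
  shows "independent_family scale I u \<longleftrightarrow> inj_on u I \<and> independent (u ` I)"
proof
  assume ind: "independent_family scale I u"
  have inj: "inj_on u I"
  proof (rule inj_onI, rule ccontr)
    fix i j assume ij: "i \<in> I" "j \<in> I" "u i = u j" "i \<noteq> j"
    define c :: "'c \<Rightarrow> 'a" where "c k = (if k = i then 1 else 0) - (if k = j then 1 else 0)" for k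
    have delta: "(\<Sum>k\<in>I. scale (if k = l then 1 else 0) (u k)) = u l" if "l \<in> I" for l
    proof -
      have "(\<Sum>k\<in>I. scale (if k = l then 1 else 0) (u k)) = (\<Sum>k\<in>I. if k = l then u k else 0)"
        by (rule sum.cong) auto
      then show ?thesis
        using that assms by simp
    qed
    have "(\<Sum>k\<in>I. scale (c k) (u k)) = u i - u j"
      using ij by (simp add: c_def scale_left_diff_distrib sum_subtractf delta)
    then have "c i = 0"
      using ind ij by (simp add: independent_family_def)
    then show False
      using ij by (simp add: c_def)
  qed
  moreover have "independent (u ` I)"
  proof -
    have "c x = 0" if "(\<Sum>x\<in>u ` I. scale (c x) x) = 0" "x \<in> u ` I" for c x
    proof -
      have "(\<Sum>i\<in>I. scale ((c \<circ> u) i) (u i)) = 0"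
        using that(1) by (simp add: sum.reindex[OF inj])
      then have "\<forall>i\<in>I. (c \<circ> u) i = 0"
        using ind unfolding independent_family_def by blast
      then show ?thesis
        using that(2) by auto
    qed
    then show ?thesis
      using assms by (auto simp: dependent_finite)
  qed
  ultimately show "inj_on u I \<and> independent (u ` I)" ..
next
  assume *: "inj_on u I \<and> independent (u ` I)"
  then have inj: "inj_on u I" by blast
  show "independent_family scale I u"
    unfolding independent_family_def
  proof (intro allI impI ballI)
    fix c i assume c: "(\<Sum>i\<in>I. scale (c i) (u i)) = 0" and i: "i \<in> I"
    define d where "d x = c (the_inv_into I u x)" for x
    have d: "d (u k) = c k" if "k \<in> I" for k
      using that by (simp add: d_def the_inv_into_f_f[OF inj])
    have "(\<Sum>x\<in>u ` I. scale (d x) x) = (\<Sum>i\<in>I. scale (c i) (u i))"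
      by (simp add: sum.reindex[OF inj] d)
    then have "d (u i) = 0"
      using independentD[of "u ` I" "u ` I" d "u i"] * c i assms by simp
    then show "c i = 0"
      using d i by simp
  qed
qed

text \<open>A spanning family of \<open>dimension\<close> many vectors cannot repeat a vector, because its range
  already needs \<open>dimension\<close> elements to span.\<close>

lemma (in finite_dimensional_vector_space) spans_iff_independent_family:
  assumes "finite I" and "card I = dimension"
  shows "span (u ` I) = UNIV \<longleftrightarrow> independent_family scale I u"
proof -
  have "inj_on u I" if "span (u ` I) = UNIV"
  proof -
    have "dimension \<le> card (u ` I)"
      using dim_le_card[of UNIV "u ` I"] that assms(1) by (simp add: dimension_def)
    then have "card (u ` I) = card I"
      using assms card_image_le[of I u] by simp
    then show ?thesis
      by (rule eq_card_imp_inj_on[OF assms(1)])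
  qed
  moreover have "independent (u ` I) \<longleftrightarrow> span (u ` I) = UNIV" if "inj_on u I"
    using card_eq_dim[of "u ` I" UNIV] assms that
    by (auto simp: card_image dimension_def)
  ultimately show ?thesis
    unfolding independent_family_iff[OF assms(1)] by blast
qed

section \<open>Exchanging basis vectors\<close>

text \<open>The coordinates with index outside \<open>K\<close> put no condition on the coefficients in \<open>K\<close>: given
  a kernel vector on \<open>K\<close>, they are solved by the choice of the coefficients outside \<open>K\<close>.\<close>

lemma exchange_independent_iff:
  fixes scale :: "'k::field \<Rightarrow> 'v::ab_group_add \<Rightarrow> 'v"
  assumes "vector_space scale"
    and v: "independent_family scale {..<n} v"
    and w: "\<And>i. i < n \<Longrightarrow> w i = (\<Sum>j<n. scale (A $$ (j, i)) (v j))"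
    and K: "K \<subseteq> {..<n}"
  shows "independent_family scale {..<n} (\<lambda>i. if i \<in> K then w i else v i)
    \<longleftrightarrow> trivial_kernel_on A K"
proof -
  interpret vector_space scale by fact
  let ?u = "\<lambda>i. if i \<in> K then w i else v i"
  have split: "(\<Sum>i<n. f i) = (\<Sum>i\<in>{..<n} - K. f i) + (\<Sum>i\<in>K. f i)" for f :: "nat \<Rightarrow> 'v"
    using sum.subset_diff[OF K] by simp
  have coords: "(\<Sum>i<n. scale (c i) (?u i)) =
      (\<Sum>j<n. scale ((if j \<in> K then 0 else c j) + (\<Sum>i\<in>K. A $$ (j, i) * c i)) (v j))" for c
  proof -
    have "(\<Sum>i\<in>K. scale (c i) (w i)) = (\<Sum>i\<in>K. \<Sum>j<n. scale (A $$ (j, i) * c i) (v j))"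
      using K by (intro sum.cong) (auto simp: w scale_sum_right mult.commute)
    also have "\<dots> = (\<Sum>j<n. scale (\<Sum>i\<in>K. A $$ (j, i) * c i) (v j))"
      by (subst sum.swap) (simp add: scale_sum_left)
    finally have K_part: "(\<Sum>i\<in>K. scale (c i) (?u i)) =
        (\<Sum>j<n. scale (\<Sum>i\<in>K. A $$ (j, i) * c i) (v j))"
      by simp
    have "(\<Sum>i\<in>{..<n} - K. scale (c i) (?u i)) = (\<Sum>j<n. scale (if j \<in> K then 0 else c j) (v j))"
      unfolding split[of "\<lambda>j. scale (if j \<in> K then 0 else c j) (v j)"] by simp
    then show ?thesis
      unfolding split[of "\<lambda>i. scale (c i) (?u i)"] K_part
      by (simp add: scale_left_distrib sum.distrib)
  qed
  have relation_iff: "(\<Sum>i<n. scale (c i) (?u i)) = 0 \<longleftrightarrow>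
      (\<forall>j<n. (if j \<in> K then 0 else c j) + (\<Sum>i\<in>K. A $$ (j, i) * c i) = 0)" (is "?L c \<longleftrightarrow> ?R c")
    for c
  proof
    assume "?L c"
    then show "?R c"
      using v[unfolded independent_family_def, rule_format,
          of "\<lambda>j. (if j \<in> K then 0 else c j) + (\<Sum>i\<in>K. A $$ (j, i) * c i)"]
      unfolding coords by blast
  next
    assume "?R c"
    then show "?L c"
      unfolding coords by (intro sum.neutral) simp
  qed
  show ?thesis
  proof
    assume u: "independent_family scale {..<n} ?u"
    show "trivial_kernel_on A K"
      unfolding trivial_kernel_on_def
    proof (intro allI impI)
      fix c assume c: "\<forall>j\<in>K. (\<Sum>i\<in>K. A $$ (j, i) * c i) = 0"
      define d where "d j = (if j \<in> K then c j else - (\<Sum>i\<in>K. A $$ (j, i) * c i))" for j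
      have "(\<Sum>i\<in>K. A $$ (j, i) * d i) = (\<Sum>i\<in>K. A $$ (j, i) * c i)" for j
        by (simp add: d_def)
      then have "(\<Sum>i<n. scale (d i) (?u i)) = 0"
        unfolding relation_iff using c by (simp add: d_def)
      then have "\<forall>i<n. d i = 0"
        using u unfolding independent_family_def by blast
      moreover have "d i = c i" if "i \<in> K" for i
        using that by (simp add: d_def)
      ultimately show "\<forall>i\<in>K. c i = 0"
        using K by fastforce
    qed
  next
    assume ker: "trivial_kernel_on A K"
    show "independent_family scale {..<n} ?u"
      unfolding independent_family_def
    proof (intro allI impI)
      fix c assume "(\<Sum>i<n. scale (c i) (?u i)) = 0"
      then have rel: "\<forall>j<n. (if j \<in> K then 0 else c j) + (\<Sum>i\<in>K. A $$ (j, i) * c i) = 0"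
        unfolding relation_iff .
      then have "\<forall>j\<in>K. (\<Sum>i\<in>K. A $$ (j, i) * c i) = 0"
        using K by fastforce
      then have "\<forall>i\<in>K. c i = 0"
        using ker unfolding trivial_kernel_on_def by blast
      with rel show "\<forall>i\<in>{..<n}. c i = 0"
        by (auto split: if_splits)
    qed
  qed
qed

section \<open>Invertibility of submatrices\<close>

lemma invertible_mat_iff_trivial_kernel:
  fixes B :: "'k::field mat"
  assumes B: "B \<in> carrier_mat m m"
  shows "invertible_mat B \<longleftrightarrow> (\<forall>x\<in>carrier_vec m. B *\<^sub>v x = 0\<^sub>v m \<longrightarrow> x = 0\<^sub>v m)"
proof -
  have "invertible_mat B \<longleftrightarrow> det B \<noteq> 0"
  proof
    assume "invertible_mat B"
    then obtain C where "inverts_mat B C" "inverts_mat C B"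
      unfolding invertible_mat_def by blast
    then have BC: "B * C = 1\<^sub>m m" and CB: "C * B = 1\<^sub>m (dim_row C)"
      using B by (simp_all add: inverts_mat_def)
    have "C \<in> carrier_mat m m"
      using arg_cong[OF BC, of dim_col] arg_cong[OF CB, of dim_col] B by auto
    then show "det B \<noteq> 0"
      using BC det_mult[OF B, of C] by auto
  next
    assume "det B \<noteq> 0"
    from det_non_zero_imp_unit[OF B this, of "()"] show "invertible_mat B"
      using B by (auto simp: Units_def ring_mat_def invertible_mat_def inverts_mat_def)
  qed
  then show ?thesis
    unfolding det_0_iff_vec_prod_zero_field[OF B] by blast
qed

lemma bij_betw_pick:
  assumes "finite K"
  shows "bij_betw (pick K) {..<card K} K"
proof -
  have "inj_on (pick K) {..<card K}"
    by (rule linorder_inj_onI) (auto dest: pick_mono_le)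
  moreover have "pick K ` {..<card K} \<subseteq> K"
    by (auto intro: pick_in_set_le)
  ultimately show ?thesis
    using assms by (simp add: bij_betw_def card_image card_subset_eq)
qed

text \<open>Reindexing along the increasing enumeration of \<open>K\<close> removes the renumbering of rows and
  columns that a submatrix involves.\<close>

lemma invertible_submatrix_iff:
  fixes A :: "'k::field mat"
  assumes A: "A \<in> carrier_mat n n" and K: "K \<subseteq> {..<n}"
  shows "invertible_mat (submatrix A K K) \<longleftrightarrow> trivial_kernel_on A K"
proof -
  let ?m = "card K" and ?B = "submatrix A K K"
  have fin: "finite K"
    using K finite_subset by blast
  have dims: "{i. i < dim_row A \<and> i \<in> K} = K" "{i. i < dim_col A \<and> i \<in> K} = K"
    using A K by auto
  have B: "?B \<in> carrier_mat ?m ?m"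
    by (rule carrier_matI) (simp_all add: dim_submatrix dims)
  have entry: "?B $$ (k, l) = A $$ (pick K k, pick K l)" if "k < ?m" "l < ?m" for k l
    using that by (simp add: submatrix_index dims)
  have bij: "bij_betw (pick K) {..<?m} K"
    using bij_betw_pick[OF fin] .
  have all_K: "(\<forall>j\<in>K. P j) \<longleftrightarrow> (\<forall>k<?m. P (pick K k))" for P
    using bij_betw_imp_surj_on[OF bij] by (metis (no_types, lifting) imageE imageI lessThan_iff)
  have mult: "?B *\<^sub>v x = 0\<^sub>v ?m \<longleftrightarrow> (\<forall>j\<in>K. (\<Sum>i\<in>K. A $$ (j, i) * c i) = 0)"
    if x: "x \<in> carrier_vec ?m" "\<And>k. k < ?m \<Longrightarrow> x $ k = c (pick K k)" for x c
  proof -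
    have "(?B *\<^sub>v x) $ k = (\<Sum>i\<in>K. A $$ (pick K k, i) * c i)" if "k < ?m" for k
    proof -
      have "(?B *\<^sub>v x) $ k = (\<Sum>l<?m. A $$ (pick K k, pick K l) * c (pick K l))"
        using that B x
        by (auto simp: scalar_prod_def entry atLeast0LessThan intro!: sum.cong)
      also have "\<dots> = (\<Sum>i\<in>K. A $$ (pick K k, i) * c i)"
        by (rule sum.reindex_bij_betw[OF bij])
      finally show ?thesis .
    qed
    then show ?thesis
      unfolding all_K using B by (auto simp: vec_eq_iff)
  qed
  have zero: "x = 0\<^sub>v ?m \<longleftrightarrow> (\<forall>i\<in>K. c i = 0)"
    if "x \<in> carrier_vec ?m" "\<And>k. k < ?m \<Longrightarrow> x $ k = c (pick K k)" for x c
    unfolding all_K using that by (auto simp: vec_eq_iff)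
  show ?thesis
    unfolding invertible_mat_iff_trivial_kernel[OF B] trivial_kernel_on_def
  proof safe
    fix c i
    assume ker: "\<forall>x\<in>carrier_vec ?m. ?B *\<^sub>v x = 0\<^sub>v ?m \<longrightarrow> x = 0\<^sub>v ?m"
      and c: "\<forall>j\<in>K. (\<Sum>i\<in>K. A $$ (j, i) * c i) = 0" and i: "i \<in> K"
    define x where "x = vec ?m (\<lambda>k. c (pick K k))"
    have x: "x \<in> carrier_vec ?m" "\<And>k. k < ?m \<Longrightarrow> x $ k = c (pick K k)"
      by (simp_all add: x_def)
    show "c i = 0"
      using mult[OF x] zero[OF x] ker c x(1) i by blast
  next
    fix x :: "'k vec"
    assume ker: "\<forall>c. (\<forall>j\<in>K. (\<Sum>i\<in>K. A $$ (j, i) * c i) = 0) \<longrightarrow> (\<forall>i\<in>K. c i = 0)"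
      and x: "x \<in> carrier_vec ?m" and Bx: "?B *\<^sub>v x = 0\<^sub>v ?m"
    define c where "c i = x $ the_inv_into {..<?m} (pick K) i" for i
    have c: "x $ k = c (pick K k)" if "k < ?m" for k
      using that by (simp add: c_def the_inv_into_f_f[OF bij_betw_imp_inj_on[OF bij]])
    show "x = 0\<^sub>v ?m"
      using mult[OF x c] zero[OF x c] ker Bx by blast
  qed
qed

section \<open>Woven bases\<close>

theorem theorem2p6:
  fixes scale :: "'k::real_normed_field \<Rightarrow> 'v::ab_group_add \<Rightarrow> 'v"
    and n :: nat and v w :: "nat \<Rightarrow> 'v" and A :: "'k mat"
  assumes "vector_space scale"
    and "vector_space.dim scale (UNIV :: 'v set) = n"
    and "basis_family scale {..<n} v"
    and "basis_family scale {..<n} w"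
    and "change_of_basis_mat scale n v w A"
  shows "woven scale {..<n} v w \<longleftrightarrow>
    (\<forall>B \<in> central_submatrices A. invertible_mat B)"
proof -
  interpret vector_space scale by fact
  have v: "inj_on v {..<n}" "independent (v ` {..<n})" "span (v ` {..<n}) = UNIV"
    and w: "span (w ` {..<n}) = UNIV"
    using assms(3,4) by (simp_all add: basis_family_def)
  interpret finite_dimensional_vector_space scale "v ` {..<n}"
    using v by unfold_locales auto
  have A: "A \<in> carrier_mat n n"
    and wA: "\<And>i. i < n \<Longrightarrow> w i = (\<Sum>j<n. scale (A $$ (j, i)) (v j))"
    using assms(5) by (auto simp: change_of_basis_mat_def)
  have dim: "card {..<n} = dimension"
    by (simp add: dimension_def card_image[OF v(1)])
  have indep: "independent_family scale {..<n} v"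
    using v by (simp add: independent_family_iff)
  have frame_iff: "frame scale {..<n} (\<lambda>i. if i \<in> K then w i else v i) \<longleftrightarrow>
      invertible_mat (submatrix A K K)" if "K \<subseteq> {..<n}" for K
  proof -
    have "frame scale {..<n} (\<lambda>i. if i \<in> K then w i else v i) \<longleftrightarrow>
        independent_family scale {..<n} (\<lambda>i. if i \<in> K then w i else v i)"
      unfolding frame_def spans_iff_independent_family[OF finite_lessThan dim] by simp
    also have "\<dots> \<longleftrightarrow> trivial_kernel_on A K"
      by (rule exchange_independent_iff[OF assms(1) indep wA that])
    also have "\<dots> \<longleftrightarrow> invertible_mat (submatrix A K K)"
      by (rule invertible_submatrix_iff[OF A that, symmetric])
    finally show ?thesis .
  qed
  have frames: "frame scale {..<n} v" "frame scale {..<n} w"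
    using v w by (simp_all add: frame_def)
  \<comment> \<open>\<open>J\<close> collects the indices of the vectors kept from \<open>v\<close>, so the submatrix is indexed by its
    complement.\<close>
  have compl: "frame scale {..<n} (\<lambda>i. if i \<in> J then v i else w i) \<longleftrightarrow>
      frame scale {..<n} (\<lambda>i. if i \<in> {..<n} - J then w i else v i)" for J
  proof -
    have "(\<lambda>i. if i \<in> J then v i else w i) ` {..<n} =
        (\<lambda>i. if i \<in> {..<n} - J then w i else v i) ` {..<n}"
      by (rule image_cong) auto
    then show ?thesis
      by (simp only: frame_def)
  qed
  have "woven scale {..<n} v w \<longleftrightarrow>
      (\<forall>K\<subseteq>{..<n}. frame scale {..<n} (\<lambda>i. if i \<in> K then w i else v i))"
  proof
    assume "woven scale {..<n} v w"
    then have *: "\<forall>J\<subseteq>{..<n}. frame scale {..<n} (\<lambda>i. if i \<in> {..<n} - J then w i else v i)"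
      unfolding woven_def compl by (elim conjE)
    show "\<forall>K\<subseteq>{..<n}. frame scale {..<n} (\<lambda>i. if i \<in> K then w i else v i)"
    proof (intro allI impI)
      fix K assume "K \<subseteq> {..<n}"
      then show "frame scale {..<n} (\<lambda>i. if i \<in> K then w i else v i)"
        using *[rule_format, of "{..<n} - K"] by (simp add: double_diff)
    qed
  next
    assume "\<forall>K\<subseteq>{..<n}. frame scale {..<n} (\<lambda>i. if i \<in> K then w i else v i)"
    then show "woven scale {..<n} v w"
      unfolding woven_def compl using frames by (meson Diff_subset)
  qed
  also have "\<dots> \<longleftrightarrow> (\<forall>K\<subseteq>{..<n}. K \<noteq> {} \<longrightarrow>
      frame scale {..<n} (\<lambda>i. if i \<in> K then w i else v i))"
  proof -
    have drop_empty: "(\<forall>K\<subseteq>S. P K) \<longleftrightarrow> (\<forall>K\<subseteq>S. K \<noteq> {} \<longrightarrow> P K)"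
      if "P {}" for P and S :: "nat set"
      using that by metis
    show ?thesis
      by (rule drop_empty) (simp add: frames(1))
  qed
  also have "\<dots> \<longleftrightarrow> (\<forall>K\<subseteq>{..<n}. K \<noteq> {} \<longrightarrow> invertible_mat (submatrix A K K))"
    using frame_iff by (intro all_cong1 imp_cong refl)
  also have "\<dots> \<longleftrightarrow> (\<forall>B \<in> central_submatrices A. invertible_mat B)"
    unfolding central_submatrices_def carrier_matD(1)[OF A] by blast
  finally show ?thesis .
qed

end
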